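(* Let $G$ be a finite, simple, loopless, regular, connected graph, and let $r$ be a positive integer with $r \leq \operatorname{diam}(G)$. Then \[ e(G^{r}) \geq \left( \left\lceil \frac{r}{3} \right\rceil -1 \right) e(G). \]
   Context: For vertices $u,v$ of $G$, $\operatorname{dist}(u,v)$ is the length of a shortest path between them. The $r$th power $G^r$ of $G$ is the graph on $V(G)$ in which two distinct vertices $x,y$ are adjacent if and only if $\operatorname{dist}(x,y)\leq r$ in $G$. The diameter $\operatorname{diam}(G)$ is the maximum distance between two vertices of $G$ (equivalently the least $r$ such that $G^r$ is complete). $e(H)$ denotes the number of edges of a graph $H$. *)

theory Defs
  imports "Graph_Theory.Graph_Theory" "HOL-Library.Extended_Nat"
begin

text \<open>
  A finite simple loopless undirected graph is a \<^locale>\<open>pair_graph\<close>: every edge \<open>{u, v}\<close> is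
  represented by the two arcs \<open>(u, v)\<close> and \<open>(v, u)\<close>.
\<close>

definition regular_graph :: "'a pair_pre_digraph \<Rightarrow> bool" where
  "regular_graph G \<longleftrightarrow> (\<exists>d. \<forall>v \<in> pverts G. out_degree (with_proj G) v = d)"

text \<open>Counted without orientation, so the two opposite arcs of an edge contribute once.\<close>

definition edge_count :: "'a pair_pre_digraph \<Rightarrow> nat" where
  "edge_count G = card ((\<lambda>(u, v). {u, v}) ` parcs G)"

text \<open>The infimum over the empty set is \<open>\<infinity>\<close>, the distance of disconnected vertices.\<close>

definition graph_dist :: "'a pair_pre_digraph \<Rightarrow> 'a \<Rightarrow> 'a \<Rightarrow> enat" where
  "graph_dist G u v = (INF p \<in> {p. pre_digraph.apath (with_proj G) u p v}. enat (length p))"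

definition graph_diam :: "'a pair_pre_digraph \<Rightarrow> enat" where
  "graph_diam G = (SUP u \<in> pverts G. SUP v \<in> pverts G. graph_dist G u v)"

definition graph_power :: "'a pair_pre_digraph \<Rightarrow> nat \<Rightarrow> 'a pair_pre_digraph" where
  "graph_power G r =
     \<lparr> pverts = pverts G,
       parcs = {(x, y). x \<in> pverts G \<and> y \<in> pverts G \<and> x \<noteq> y \<and> graph_dist G x y \<le> enat r} \<rparr>"

lemma (in pair_sym_digraph) graph_dist_commute: "graph_dist G u v = graph_dist G v u"
proof -
  have len: "length (rev_path p) = length p" for p :: "('a \<times> 'a) list"
    by (induct p) auto
  have "graph_dist G a b \<le> graph_dist G b a" for a b
    unfolding graph_dist_def
  proof (rule INF_mono)
    fix p assume "p \<in> {p. apath b p a}"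
    then have "rev_path p \<in> {p. apath a p b}"
      by simp
    then show "\<exists>q \<in> {p. apath a p b}. enat (length q) \<le> enat (length p)"
      by (intro bexI[of _ "rev_path p"]) (auto simp: len)
  qed
  then show ?thesis
    by (blast intro: antisym)
qed

lemma (in pair_graph) pair_graph_graph_power: "pair_graph (graph_power G r)"
proof -
  have "finite {(x, y). x \<in> pverts G \<and> y \<in> pverts G \<and> x \<noteq> y \<and> graph_dist G x y \<le> enat r}"
    by (rule finite_subset[of _ "pverts G \<times> pverts G"]) (auto simp: pair_finite_verts)
  moreover have "sym {(x, y). x \<in> pverts G \<and> y \<in> pverts G \<and> x \<noteq> y \<and> graph_dist G x y \<le> enat r}"
    by (auto simp: sym_def graph_dist_commute)
  ultimately show ?thesis
    by unfold_locales (auto simp: graph_power_def pair_finite_verts symmetric_def)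
qed

end

theory Submission
  imports Defs
begin

text \<open>
  Let \<open>d\<close> be the degree and \<open>k = \<lceil>r / 3\<rceil>\<close>. If some vertex lies at distance at least \<open>r\<close> from \<open>v\<close>,
  then each distance \<open>0, 3, 6, \<dots>, 3 (k - 1)\<close> from \<open>v\<close> is attained, and the closed neighbourhoods
  of vertices at these distances are pairwise disjoint subsets of the ball of radius \<open>r\<close> about \<open>v\<close>;
  so this ball has at least \<open>k (d + 1)\<close> elements. Otherwise the ball is the whole vertex set, which is
  at least as large because it contains such a ball about an end of a diameter. Hence every degree in
  the \<open>r\<close>th power is at least \<open>k (d + 1) - 1 \<ge> k d\<close>, and the bound holds even with the factor \<open>k\<close>.
\<close>

section \<open>Distances expressed through walks\<close>

lemma (in wf_digraph) length_awalk_to_apath_le: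
  assumes "awalk u p v"
  shows "length (awalk_to_apath p) \<le> length p"
  using assms
proof (induct rule: awalk_to_apath_induct)
  case (path p)
  then show ?case by (auto simp: awalk_to_apath.simps)
next
  case (decomp p q r s)
  \<comment> \<open>\<open>q @ s\<close> is \<open>p\<close> with a closed sub-walk cut out, so loop
    removal never lengthens a walk.\<close>
  have "length (q @ s) \<le> length p"
    using decomp by (auto elim!: awalk_cyc_decompE)
  with decomp step_awalk_to_apath[of _ p _ q r s] show ?case by simp
qed

context pair_wf_digraph
begin

text \<open>This trades paths for walks, which can be extended and cut without checking that
  vertices stay distinct. A finite bound excludes the empty infimum, and since \<open>enat\<close>
  is well-ordered the infimum is attained.\<close>

lemma graph_dist_le_iff:
  "graph_dist G u v \<le> enat n \<longleftrightarrow> (\<exists>p. awalk u p v \<and> length p \<le> n)"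
proof
  let ?L = "(\<lambda>p. enat (length p)) ` {p. apath u p v}"
  assume le: "graph_dist G u v \<le> enat n"
  then have "?L \<noteq> {}"
    unfolding graph_dist_def by (metis Inf_empty enat_ord_simps(5) top_enat_def enat.distinct(1))
  then have "Inf ?L \<in> ?L" by (metis wellorder_InfI ex_in_conv)
  with le show "\<exists>p. awalk u p v \<and> length p \<le> n"
    by (auto simp: graph_dist_def intro: awalkI_apath)
next
  assume "\<exists>p. awalk u p v \<and> length p \<le> n"
  then obtain p where p: "awalk u p v" "length p \<le> n" by blast
  have "graph_dist G u v \<le> enat (length (awalk_to_apath p))"
    unfolding graph_dist_def using apath_awalk_to_apath[OF p(1)] by (intro INF_lower) simp
  also have "\<dots> \<le> enat n" using length_awalk_to_apath_le[OF p(1)] p(2) by simp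
  finally show "graph_dist G u v \<le> enat n" .
qed

lemma graph_dist_self: "v \<in> pverts G \<Longrightarrow> graph_dist G v v = 0"
  using graph_dist_le_iff[of v v 0] by (auto simp: awalk_Nil_iff zero_enat_def[symmetric])

lemma graph_dist_arc_le:
  assumes "(x, y) \<in> parcs G"
  shows "graph_dist G v y \<le> eSuc (graph_dist G v x)"
proof (cases "graph_dist G v x")
  case (enat n)
  then obtain p where p: "awalk v p x" "length p \<le> n"
    using graph_dist_le_iff[of v x n] by auto
  have "awalk v (p @ [(x, y)]) y"
    using p(1) arc_implies_awalk[of "(x, y)"] assms by (intro awalk_appendI) auto
  then have "graph_dist G v y \<le> enat (Suc n)"
    using p(2) by (subst graph_dist_le_iff) (intro exI[of _ "p @ [(x, y)]"], simp)
  with enat show ?thesis by (simp add: eSuc_enat)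
qed simp

text \<open>The last arc of a shortest walk supplies \<open>x\<close>: dropping it gives distance at
  most \<open>n\<close>, and a smaller value would bring \<open>w\<close> closer than
  \<open>Suc n\<close>.\<close>

lemma graph_dist_predecessor:
  assumes "graph_dist G v w = enat (Suc n)"
  shows "\<exists>x. (x, w) \<in> parcs G \<and> graph_dist G v x = enat n"
proof -
  obtain p where p: "awalk v p w" "length p \<le> Suc n"
    using graph_dist_le_iff[of v w "Suc n"] assms by auto
  have "p \<noteq> []"
  proof
    assume "p = []"
    with p(1) have "graph_dist G v w = 0" using graph_dist_self by (auto simp: awalk_Nil_iff)
    with assms show False by (simp add: zero_enat_def)
  qed
  then obtain q e where q: "p = q @ [e]" by (cases p rule: rev_cases) auto
  obtain x y where e: "e = (x, y)" by (cases e)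
  have qx: "awalk v q x" "(x, y) \<in> parcs G" "y = w"
    using p(1) unfolding q e by (auto simp: awalk_Cons_iff awalk_Nil_iff)
  have "graph_dist G v x \<le> enat n"
    using qx(1) p(2) q by (auto simp: graph_dist_le_iff)
  moreover from this have "enat n \<le> graph_dist G v x"
    using graph_dist_arc_le[OF qx(2), of v] assms qx(3)
    by (cases "graph_dist G v x") (auto simp: eSuc_enat)
  ultimately show ?thesis using qx by auto
qed

text \<open>Stepping back from \<open>w\<close> through predecessors lowers the distance by exactly
  one each time.\<close>

lemma graph_dist_attained:
  assumes "w \<in> pverts G" and "graph_dist G v w = enat n" and "j \<le> n"
  shows "\<exists>x \<in> pverts G. graph_dist G v x = enat j"
  using assms
proof (induction n arbitrary: w)
  case (Suc n)
  show ?case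
  proof (cases "j = Suc n")
    case False
    with Suc graph_dist_predecessor[OF Suc.prems(2)] show ?thesis
      by (metis in_arcsD1 le_SucE)
  qed (use Suc in auto)
qed auto

end

section \<open>Counting arcs and edges\<close>

lemma (in pair_wf_digraph) out_degree_eq_card_successors:
  "out_degree (with_proj G) v = card {y. (v, y) \<in> parcs G}"
proof -
  have "out_arcs (with_proj G) v = Pair v ` {y. (v, y) \<in> parcs G}"
    by (auto simp: out_arcs_def)
  then show ?thesis by (simp add: out_degree_def card_image inj_on_def)
qed

lemma (in pair_fin_digraph) card_parcs_eq_sum:
  "card (parcs G) = (\<Sum>v \<in> pverts G. card {y. (v, y) \<in> parcs G})"
proof -
  have "parcs G = Sigma (pverts G) (\<lambda>v. {y. (v, y) \<in> parcs G})"
    by (auto dest: in_arcsD1)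
  moreover have "finite {y. (v, y) \<in> parcs G}" for v
    by (rule finite_subset[OF _ pair_finite_verts]) (auto dest: in_arcsD2)
  ultimately show ?thesis
    using card_SigmaI[OF pair_finite_verts, of "\<lambda>v. {y. (v, y) \<in> parcs G}"] by simp
qed

text \<open>Forgetting orientation has fibres of size two: by symmetry both orientations occur, and
  without loops they differ.\<close>

lemma (in pair_graph) card_parcs_eq_edge_count: "card (parcs G) = 2 * edge_count G"
proof -
  let ?f = "\<lambda>(u, v). {u, v}"
  have "card {a \<in> parcs G. ?f a = e} = 2" if "e \<in> ?f ` parcs G" for e
  proof -
    from that obtain u v where uv: "(u, v) \<in> parcs G" "e = {u, v}" by auto
    then have "{a \<in> parcs G. ?f a = e} = {(u, v), (v, u)}"
      using arcs_symmetric by (auto simp: doubleton_eq_iff)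
    moreover have "u \<noteq> v" using uv no_loops' by auto
    ultimately show ?thesis by simp
  qed
  then show ?thesis
    using sum.image_gen[OF pair_finite_arcs, of "\<lambda>_. 1::nat" ?f] by (simp add: edge_count_def)
qed

lemma graph_diam_witness:
  assumes "enat r \<le> graph_diam G" and "r \<ge> 1"
  shows "\<exists>u \<in> pverts G. \<exists>v \<in> pverts G. enat r \<le> graph_dist G u v"
proof (rule ccontr)
  assume "\<not> ?thesis"
  then have "graph_dist G u v \<le> enat (r - 1)" if "u \<in> pverts G" "v \<in> pverts G" for u v
    using that assms(2) by (cases "graph_dist G u v") (fastforce simp: not_le)+
  then have "graph_diam G \<le> enat (r - 1)"
    unfolding graph_diam_def by (intro SUP_least)
  with assms have "enat r \<le> enat (r - 1)" by (meson order_trans)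
  with assms(2) show False by simp
qed

section \<open>Ball sizes and the edge bound\<close>

context pair_graph
begin

lemma graph_dist_finite:
  assumes "connected (with_proj G)" and "u \<in> pverts G" and "v \<in> pverts G"
  shows "\<exists>n. graph_dist G u v = enat n"
proof -
  have "u \<rightarrow>\<^sup>*\<^bsub>with_proj G\<^esub> v"
    using symmetric_connected_imp_strongly_connected[OF sym_arcs assms(1)] assms(2,3)
    by (auto elim: strongly_connectedE)
  then obtain p where "awalk u p v" by (auto simp: reachable_awalk)
  then have "graph_dist G u v \<le> enat (length p)" by (auto simp: graph_dist_le_iff)
  then show ?thesis by (cases "graph_dist G u v") auto
qed

text \<open>For \<open>r \<ge> 1\<close>, \<open>Suc ((r - 1) div 3)\<close> is the ceiling of
  \<open>r / 3\<close>, written without leaving the naturals.\<close>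

lemma card_ball_ge:
  assumes conn: "connected (with_proj G)"
    and deg: "\<forall>v \<in> pverts G. out_degree (with_proj G) v = d"
    and v: "v \<in> pverts G" and w: "w \<in> pverts G"
    and far: "enat r \<le> graph_dist G v w" and r: "r \<ge> 1"
  shows "Suc ((r - 1) div 3) * Suc d \<le> card {y \<in> pverts G. graph_dist G v y \<le> enat r}"
proof -
  let ?m = "(r - 1) div 3"
  let ?B = "{y \<in> pverts G. graph_dist G v y \<le> enat r}"
  define N where "N x = insert x {y. (x, y) \<in> parcs G}" for x
  obtain n where n: "graph_dist G v w = enat n" using graph_dist_finite[OF conn v w] by auto
  have "\<forall>i \<in> {..?m}. \<exists>x \<in> pverts G. graph_dist G v x = enat (3 * i)"
    using far n by (auto intro!: graph_dist_attained[OF w n])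
  then obtain x where x: "x i \<in> pverts G" "graph_dist G v (x i) = enat (3 * i)" if "i \<le> ?m" for i
    by (metis atMost_iff)
  have N_verts: "N (x i) \<subseteq> pverts G" if "i \<le> ?m" for i
    using x[OF that] by (auto simp: N_def dest: in_arcsD2)
  \<comment> \<open>Says \<open>\<bar>l - 3 * i\<bar> \<le> 1\<close> without truncated subtraction;
    the two bounds come from the two orientations of the edge between \<open>x i\<close> and
    \<open>y\<close>.\<close>
  have N_dist: "\<exists>l. graph_dist G v y = enat l \<and> l \<le> 3 * i + 1 \<and> 3 * i \<le> l + 1"
    if "i \<le> ?m" "y \<in> N (x i)" for i y
  proof (cases "y = x i")
    case False
    with that have a: "(x i, y) \<in> parcs G" by (auto simp: N_def)
    then have "(y, x i) \<in> parcs G" using arcs_symmetric by auto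
    with a show ?thesis
      using graph_dist_arc_le[of "x i" y v] graph_dist_arc_le[of y "x i" v] x[OF that(1)]
      by (cases "graph_dist G v y") (auto simp: eSuc_enat)
  qed (use x[OF that(1)] in auto)
  have N_card: "card (N (x i)) = Suc d" if "i \<le> ?m" for i
  proof -
    have "finite {y. (x i, y) \<in> parcs G}"
      by (rule finite_subset[OF _ pair_finite_verts]) (auto dest: in_arcsD2)
    moreover have "(x i, x i) \<notin> parcs G" using no_loops' by auto
    ultimately show ?thesis
      using deg x(1)[OF that] by (simp add: N_def out_degree_eq_card_successors)
  qed
  have "N (x i) \<inter> N (x j) = {}" if ij: "i \<le> ?m" "j \<le> ?m" "i \<noteq> j" for i j
  proof (rule ccontr)
    assume "\<not> ?thesis"
    then obtain y where "y \<in> N (x i)" "y \<in> N (x j)" by auto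
    with N_dist ij obtain l where "l \<le> 3 * i + 1" "3 * i \<le> l + 1" "l \<le> 3 * j + 1" "3 * j \<le> l + 1"
      by (metis enat.inject)
    \<comment> \<open>Both \<open>3 * i\<close> and \<open>3 * j\<close> are within 1 of
      \<open>l\<close>, hence within 2 of each other, which forces \<open>i = j\<close>.\<close>
    with ij(3) show False by presburger
  qed
  then have "card (\<Union>i \<in> {..?m}. N (x i)) = (\<Sum>i \<in> {..?m}. card (N (x i)))"
    by (intro card_UN_disjoint) (auto intro: finite_subset[OF N_verts pair_finite_verts])
  also have "\<dots> = Suc ?m * Suc d" using N_card by simp
  finally have "card (\<Union>i \<in> {..?m}. N (x i)) = Suc ?m * Suc d" .
  moreover have "(\<Union>i \<in> {..?m}. N (x i)) \<subseteq> ?B"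
  proof
    fix y assume "y \<in> (\<Union>i \<in> {..?m}. N (x i))"
    then obtain i where i: "i \<le> ?m" "y \<in> N (x i)" by auto
    \<comment> \<open>The last centre is at distance at most \<open>r - 1\<close>, leaving room for
      its neighbours inside the ball.\<close>
    then have "3 * i + 1 \<le> r" using r by linarith
    with N_dist[OF i] N_verts[OF i(1)] i(2) show "y \<in> ?B" by auto
  qed
  moreover have "finite ?B" using pair_finite_verts by simp
  ultimately show ?thesis by (metis card_mono)
qed

lemma card_punctured_ball_ge:
  assumes conn: "connected (with_proj G)"
    and deg: "\<forall>v \<in> pverts G. out_degree (with_proj G) v = d"
    and r: "r \<ge> 1" and diam: "enat r \<le> graph_diam G" and v: "v \<in> pverts G"
  shows "Suc ((r - 1) div 3) * d \<le> card {y \<in> pverts G. v \<noteq> y \<and> graph_dist G v y \<le> enat r}"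
proof -
  let ?B = "\<lambda>v. {y \<in> pverts G. graph_dist G v y \<le> enat r}"
  let ?P = "{y \<in> pverts G. v \<noteq> y \<and> graph_dist G v y \<le> enat r}"
  have "Suc ((r - 1) div 3) * Suc d \<le> card (?B v)"
  proof (cases "\<exists>w \<in> pverts G. enat r \<le> graph_dist G v w")
    case True
    then show ?thesis using card_ball_ge[OF conn deg v] r by blast
  next
    case False
    then have "?B v = pverts G" by auto
    moreover obtain u w where "u \<in> pverts G" "w \<in> pverts G" "enat r \<le> graph_dist G u w"
      using graph_diam_witness[OF diam r] by auto
    then have "Suc ((r - 1) div 3) * Suc d \<le> card (?B u)"
      using card_ball_ge[OF conn deg] r by blast
    moreover have "card (?B u) \<le> card (pverts G)"
      using pair_finite_verts by (intro card_mono) auto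
    ultimately show ?thesis by simp
  qed
  also have "?B v = insert v ?P" using v graph_dist_self by auto
  also have "card (insert v ?P) = Suc (card ?P)" using pair_finite_verts by simp
  \<comment> \<open>Removing the centre costs one element, covered by the surplus of
    \<open>Suc ((r - 1) div 3) \<ge> 1\<close> of the product with \<open>Suc d\<close> over the
    product with \<open>d\<close>.\<close>
  finally show ?thesis by simp
qed

lemma edge_count_graph_power_ge:
  assumes "connected (with_proj G)" and "regular_graph G"
    and "r \<ge> 1" and "enat r \<le> graph_diam G"
  shows "Suc ((r - 1) div 3) * edge_count G \<le> edge_count (graph_power G r)"
proof -
  let ?k = "Suc ((r - 1) div 3)"
  interpret P: pair_graph "graph_power G r" by (rule pair_graph_graph_power)
  obtain d where d: "\<forall>v \<in> pverts G. out_degree (with_proj G) v = d"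
    using assms(2) by (auto simp: regular_graph_def)
  have "?k * card (parcs G) = (\<Sum>v \<in> pverts G. ?k * d)"
    using d by (simp add: card_parcs_eq_sum out_degree_eq_card_successors algebra_simps)
  also have "\<dots> \<le> (\<Sum>v \<in> pverts G. card {y \<in> pverts G. v \<noteq> y \<and> graph_dist G v y \<le> enat r})"
    using card_punctured_ball_ge[OF assms(1) d assms(3,4)] by (intro sum_mono)
  \<comment> \<open>The punctured ball about \<open>v\<close> is the set of neighbours of
    \<open>v\<close> in the power.\<close>
  also have "\<dots> = card (parcs (graph_power G r))"
    by (subst P.card_parcs_eq_sum)
       (auto simp: graph_power_def intro!: sum.cong arg_cong[where f = card])
  finally show ?thesis
    \<comment> \<open>Both sides count arcs, so the common factor 2 cancels.\<close>
    by (simp only: card_parcs_eq_edge_count P.card_parcs_eq_edge_count)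
qed

end

theorem theorem3:
  fixes G :: "'a pair_pre_digraph" and r :: nat
  assumes "pair_graph G"
    and "regular_graph G"
    and "Digraph_Component.connected (with_proj G)"
    and "r \<ge> 1"
    and "enat r \<le> graph_diam G"
  shows "int (edge_count (graph_power G r)) \<ge> (\<lceil>real r / 3\<rceil> - 1) * int (edge_count G)"
proof -
  let ?k = "Suc ((r - 1) div 3)"
  have "r \<le> 3 * ?k" using assms(4) by presburger
  then have "real r / 3 \<le> of_int (int ?k)" by linarith
  then have "\<lceil>real r / 3\<rceil> - 1 \<le> int ?k" by (simp only: ceiling_le_iff[symmetric])
  then have "(\<lceil>real r / 3\<rceil> - 1) * int (edge_count G) \<le> int ?k * int (edge_count G)"
    by (intro mult_right_mono) auto
  also have "\<dots> \<le> int (edge_count (graph_power G r))"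
    using pair_graph.edge_count_graph_power_ge[OF assms(1,3,2,4,5)]
    by (simp only: of_nat_mult[symmetric] of_nat_le_iff)
  finally show ?thesis .
qed

end
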